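(* Let $n,r,s$ be integers with $n\geq 2r+1$, $r\geq 0$ and $s\geq 1$. Then $$\Lambda_{n,r,s}(\tau)=\frac{1}{n!}\Big(\tau^n-s\sum_{j=0}^r\binom{n}{j}(\tau-1)^j\Big).$$ In particular, $$\Lambda_{n,0,s}(\tau)=\frac{\tau^n-s}{n!}\quad\text{and}\quad g_{n,0,s}=\sqrt[n]{s}.$$
   Context: For integers $n\geq 2r+1$, $r\geq 0$, $s\geq 1$, $m\geq 1$ let $$c_{n,r,m,t}=\sum_{0\leq i<m}\binom{t-i+r}{r}\binom{i+n-r-1}{n-r-1},$$ regarded as a polynomial in $t$ (with $\binom{x+a}{a}=\frac{(x+a)\cdots(x+1)}{a!}$), and let $P_{n,r,s,m}(t)=\binom{t+n}{n}-s\,c_{n,r,m,t}$, a polynomial in $t$ of degree $n$. Substituting $t=m\tau$, the expression $P_{n,r,s,m}(m\tau)$ is a polynomial in $m$ of degree $n$ with coefficients in $\mathbb{Q}[\tau]$; $\Lambda_{n,r,s}(\tau)\in\mathbb{Q}[\tau]$ denotes the coefficient of $m^n$ in it. $g_{n,r,s}$ denotes the largest real root of $\Lambda_{n,r,s}$. *)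

theory Defs
  imports Complex_Main "HOL-Computational_Algebra.Polynomial"
begin

text \<open>
  The polynomial \<open>binom(x + a, a) = (x + a) \<cdots> (x + 1) / a!\<close> in \<open>x\<close>.
\<close>
definition binom_poly :: "nat \<Rightarrow> rat poly" where
  "binom_poly a = smult (1 / fact a) (\<Prod>k=1..a. [:of_nat k, 1:])"

text \<open>
  In the next two definitions the polynomial variable is \<open>t\<close>. The factor
  \<open>binom(t - i + r, r)\<close> is \<^const>\<open>binom_poly\<close> at \<open>x = t - i\<close>. The natural number
  subtraction \<open>n - r - 1\<close> is exact in the intended range \<open>n \<ge> 2 * r + 1\<close>.
\<close>
definition c_poly :: "nat \<Rightarrow> nat \<Rightarrow> nat \<Rightarrow> rat poly" where
  "c_poly n r m =
     (\<Sum>i<m. smult (of_nat ((i + (n - r - 1)) choose (n - r - 1)))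
                  (pcompose (binom_poly r) [:- of_nat i, 1:]))"

definition P_poly :: "nat \<Rightarrow> nat \<Rightarrow> nat \<Rightarrow> nat \<Rightarrow> rat poly" where
  "P_poly n r s m = binom_poly n - smult (of_nat s) (c_poly n r m)"

text \<open>
  \<open>P_poly n r s m\<close> at \<open>t = m * \<tau>\<close>, as a polynomial in \<open>m\<close> with coefficients in \<open>\<rat>[\<tau>]\<close>:
  the outer variable of the \<^typ>\<open>rat poly poly\<close> is \<open>m\<close>, the inner one is \<open>\<tau>\<close>. Since \<open>m\<close> is
  also the number of summands in \<^const>\<open>c_poly\<close>, this polynomial is specified by its values
  at the positive integers \<open>m\<close>, which determine it.
\<close>
definition P_scaled :: "nat \<Rightarrow> nat \<Rightarrow> nat \<Rightarrow> rat poly poly" where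
  "P_scaled n r s =
     (THE Q. \<forall>m\<ge>1. poly Q (of_nat m) = pcompose (P_poly n r s m) [:0, of_nat m:])"

definition Lambda :: "nat \<Rightarrow> nat \<Rightarrow> nat \<Rightarrow> rat poly" where
  "Lambda n r s = coeff (P_scaled n r s) n"

definition g :: "nat \<Rightarrow> nat \<Rightarrow> nat \<Rightarrow> real" where
  "g n r s = (GREATEST x. poly (map_poly of_rat (Lambda n r s)) x = 0)"

end

theory Submission imports Defs begin

text \<open>
  The double dependence of \<open>c\<^bsub>n,r,m,t\<^esub>\<close> on \<open>m\<close> (through \<open>t = m * \<tau>\<close> and through
  the number of summands) is removed by a closed form. Write \<open>h x k = x (x + 1) \<cdots> (x + k - 1) / k!\<close>
  for the coefficient of \<open>z ^ k\<close> in \<open>(1 - z) powr (- x)\<close>. Multiplying such series gives the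
  convolution identity \<open>\<Sum>k\<le>N. h x k * h y (N - k) = h (x + y) N\<close>, which is Vandermonde's.
  Splitting \<open>t - i + 1 = (t - m + 1) + (m - i)\<close> expands \<open>binom(t - i + r, r)\<close> as
  \<open>\<Sum>j\<le>r. h (t - m + 1) j * h (m - i) (r - j)\<close>. The factor with \<open>t\<close> no longer contains \<open>i\<close>, and
  the sum over \<open>i\<close> of what remains is a second instance of the convolution. The result
  (\<open>poly_c_poly\<close>) is
  \[ c_{n,r,m,t} = \sum_{j=0}^{r} \binom{t-m+j}{j} \binom{m-1+n-j}{n-j}. \]

  Put \<open>t = m * \<tau>\<close>. The \<open>j\<close>-th summand is now visibly a product of \<open>n\<close> linear polynomials in \<open>m\<close>,
  of which \<open>j\<close> have slope \<open>\<tau> - 1\<close> and \<open>n - j\<close> have slope \<open>1\<close>, divided by \<open>j! (n - j)!\<close>. Hence its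
  coefficient at \<open>m ^ n\<close> is \<open>(\<tau> - 1) ^ j / (j! (n - j)!)\<close>, that is, \<open>binom(n, j) (\<tau> - 1) ^ j / n!\<close>.
  In the same way \<open>binom(t + n, n)\<close> contributes \<open>\<tau> ^ n / n!\<close>. Since a polynomial over the
  integral domain \<open>\<rat>[\<tau>]\<close> is determined by its values at the positive integers, this computes
  \<open>\<Lambda>\<close>. For \<open>r = 0\<close> the real roots are those of \<open>\<tau> ^ n = s\<close>.
\<close>

section \<open>Rising binomial coefficients\<close>

definition rising_binom :: "'a::field_char_0 \<Rightarrow> nat \<Rightarrow> 'a" where
  "rising_binom x k = pochhammer x k / fact k"

lemma rising_binom_convolution:
  "(\<Sum>k\<le>N. rising_binom x k * rising_binom y (N - k)) = rising_binom (x + y) N"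
proof -
  have "rising_binom (x + y) N
      = (\<Sum>k\<le>N. of_nat (N choose k) * pochhammer x k * pochhammer y (N - k) / fact N)"
    unfolding rising_binom_def by (subst pochhammer_binomial_sum) (simp add: sum_divide_distrib)
  also have "\<dots> = (\<Sum>k\<le>N. rising_binom x k * rising_binom y (N - k))"
    by (rule sum.cong) (simp_all add: rising_binom_def binomial_fact field_simps)
  finally show ?thesis ..
qed

lemma rising_binom_of_nat_Suc:
  "rising_binom (of_nat (Suc p)) q = (of_nat ((p + q) choose q) :: 'a::field_char_0)"
proof -
  have "(fact (p + q) :: 'a) = fact p * pochhammer (of_nat (Suc p)) q"
    using pochhammer_product'[of "1::'a" p q] by (simp add: pochhammer_fact add.commute)
  then show ?thesis
    by (simp add: rising_binom_def binomial_fact field_simps)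
qed

text \<open>
  The convolution runs over the second argument, but the summation index of \<open>c_poly\<close> appears in
  the first argument. This symmetry of binomial coefficients moves it.
\<close>

lemma rising_binom_swap:
  "rising_binom (of_nat (Suc p)) q = (rising_binom (of_nat (Suc q)) p :: 'a::field_char_0)"
  unfolding rising_binom_of_nat_Suc
  using binomial_symmetric[of q "p + q"] by (simp add: add.commute)

lemma poly_binom_poly: "poly (binom_poly a) x = rising_binom (x + 1) a"
proof -
  have "(\<Prod>k=1..a. of_nat k + x) = (\<Prod>k=0..<a. x + 1 + of_nat k)"
    by (rule prod.reindex_bij_witness[where i = Suc and j = "\<lambda>k. k - 1"])
      (auto simp: algebra_simps)
  then show ?thesis
    by (simp add: binom_poly_def rising_binom_def poly_prod pochhammer_prod)
qed

section \<open>A closed form for the sum\<close>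

text \<open>
  The right-hand side has a number of summands independent of \<open>m\<close>, so it is polynomial in \<open>m\<close>
  jointly with \<open>t\<close>.
\<close>

lemma poly_c_poly:
  assumes "r < n" and "m \<ge> 1"
  shows "poly (c_poly n r m) t
       = (\<Sum>j\<le>r. rising_binom (t - of_nat m + 1) j * rising_binom (of_nat m) (n - j))"
proof -
  obtain M where m: "m = Suc M"
    using \<open>m \<ge> 1\<close> by (cases m) auto
  obtain b where n: "n = Suc (r + b)"
    using less_imp_Suc_add[OF \<open>r < n\<close>] by blast
  let ?u = "t - of_nat m + 1"
  have split: "poly (binom_poly r) (t - of_nat i)
      = (\<Sum>j\<le>r. rising_binom ?u j * rising_binom (of_nat (Suc (r - j))) (M - i))"
    if "i \<le> M" for i
  proof -
    have "t - of_nat i + 1 = ?u + of_nat (Suc (M - i))"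
      using that by (simp add: m of_nat_diff)
    then have "poly (binom_poly r) (t - of_nat i)
        = (\<Sum>j\<le>r. rising_binom ?u j * rising_binom (of_nat (Suc (M - i))) (r - j))"
      by (simp only: poly_binom_poly rising_binom_convolution)
    then show ?thesis
      by (simp only: rising_binom_swap[of "M - i"])
  qed
  have "poly (c_poly n r m) t
      = (\<Sum>i\<le>M. rising_binom (of_nat (Suc b)) i * poly (binom_poly r) (t - of_nat i))"
  proof -
    have "of_nat ((i + b) choose b) = (rising_binom (of_nat (Suc b)) i :: rat)" for i
      by (metis rising_binom_of_nat_Suc rising_binom_swap)
    then show ?thesis
      by (simp add: c_poly_def poly_sum poly_pcompose m n lessThan_Suc_atMost del: of_nat_Suc)
  qed
  also have "\<dots> = (\<Sum>i\<le>M. \<Sum>j\<le>r. rising_binom ?u j *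
      (rising_binom (of_nat (Suc b)) i * rising_binom (of_nat (Suc (r - j))) (M - i)))"
    by (rule sum.cong) (simp_all add: split sum_distrib_left mult_ac del: of_nat_Suc)
  also have "\<dots> = (\<Sum>j\<le>r. rising_binom ?u j * (\<Sum>i\<le>M.
      rising_binom (of_nat (Suc b)) i * rising_binom (of_nat (Suc (r - j))) (M - i)))"
    by (subst sum.swap) (simp only: sum_distrib_left)
  also have "\<dots> = (\<Sum>j\<le>r. rising_binom ?u j * rising_binom (of_nat m) (n - j))"
  proof (rule sum.cong)
    fix j assume "j \<in> {..r}"
    then have "of_nat (Suc b) + of_nat (Suc (r - j)) = (of_nat (Suc (n - j)) :: rat)"
      by (simp add: n Suc_diff_le of_nat_diff)
    then show "rising_binom ?u j * (\<Sum>i\<le>M.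
        rising_binom (of_nat (Suc b)) i * rising_binom (of_nat (Suc (r - j))) (M - i))
      = rising_binom ?u j * rising_binom (of_nat m) (n - j)"
      by (simp only: rising_binom_convolution m rising_binom_swap[of M])
  qed simp
  finally show ?thesis .
qed

section \<open>The scaled polynomial\<close>

text \<open>
  \<open>binom(p * m + c + a, a)\<close> as a polynomial in \<open>m\<close>, for a slope \<open>p\<close> in \<open>\<rat>[\<tau>]\<close>.
\<close>

definition scaled_binom :: "rat poly \<Rightarrow> rat poly \<Rightarrow> nat \<Rightarrow> rat poly poly" where
  "scaled_binom p c a = smult [:1 / fact a:] (\<Prod>k=1..a. [:of_nat k + c, p:])"

lemma poly_poly_scaled_binom:
  "poly (poly (scaled_binom p c a) y) x = rising_binom (poly y x * poly p x + poly c x + 1) a"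
proof -
  have "poly (poly (scaled_binom p c a) y) x
      = poly (binom_poly a) (poly y x * poly p x + poly c x)"
    by (simp add: scaled_binom_def binom_poly_def poly_prod of_nat_poly add_ac)
  then show ?thesis
    by (simp add: poly_binom_poly)
qed

lemma coeff_mult_degree_bound:
  fixes p q :: "'a::comm_semiring_0 poly"
  assumes "degree p \<le> a" and "degree q \<le> b"
  shows "coeff (p * q) (a + b) = coeff p a * coeff q b"
proof -
  have "coeff p i * coeff q (a + b - i) = 0" if "i \<in> {..a + b} - {a}" for i
  proof (cases "i < a")
    case True
    then have "degree q < a + b - i"
      using assms by linarith
    then show ?thesis
      by (simp add: coeff_eq_0)
  next
    case False
    then have "degree p < i"
      using assms that by auto
    then show ?thesis
      by (simp add: coeff_eq_0)
  qed
  then have "coeff (p * q) (a + b) = (\<Sum>i\<in>{a}. coeff p i * coeff q (a + b - i))"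
    unfolding coeff_mult by (intro sum.mono_neutral_right) auto
  then show ?thesis
    by simp
qed

lemma degree_prod_linear_le:
  fixes c :: "'b \<Rightarrow> 'a::comm_semiring_1"
  assumes "finite A"
  shows "degree (\<Prod>k\<in>A. [:c k, p:]) \<le> card A"
  using assms
proof (induction A)
  case (insert k A)
  have "degree ([:c k, p:] * (\<Prod>k\<in>A. [:c k, p:])) \<le> 1 + card A"
    using insert.IH degree_mult_le[of "[:c k, p:]"] by (fastforce intro: order.trans)
  with insert.hyps show ?case
    by simp
qed simp

lemma coeff_prod_linear:
  fixes c :: "'b \<Rightarrow> 'a::comm_semiring_1"
  assumes "finite A"
  shows "coeff (\<Prod>k\<in>A. [:c k, p:]) (card A) = p ^ card A"
  using assms
proof (induction A)
  case (insert k A)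
  have "coeff ([:c k, p:] * (\<Prod>k\<in>A. [:c k, p:])) (1 + card A) = p * p ^ card A"
    using insert by (subst coeff_mult_degree_bound) (simp_all add: degree_prod_linear_le)
  with insert.hyps show ?case
    by (simp del: mult_pCons_left)
qed simp

lemma degree_scaled_binom_le: "degree (scaled_binom p c a) \<le> a"
  unfolding scaled_binom_def
  using degree_prod_linear_le[of "{1..a}" "\<lambda>k. of_nat k + c" p]
  by (simp add: order.trans[OF degree_smult_le])

lemma coeff_scaled_binom: "coeff (scaled_binom p c a) a = smult (1 / fact a) (p ^ a)"
  unfolding scaled_binom_def
  using coeff_prod_linear[of "{1..a}" "\<lambda>k. of_nat k + c" p] by simp

text \<open>
  Here \<open>[:0, 1:]\<close> is \<open>\<tau>\<close> and \<open>[:-1, 1:]\<close> is \<open>\<tau> - 1\<close>. The shift \<open>-1\<close> in the last factor turns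
  \<open>binom(m + n - j, n - j)\<close> into \<open>binom(m - 1 + n - j, n - j)\<close>.
\<close>

definition P_scaled_explicit :: "nat \<Rightarrow> nat \<Rightarrow> nat \<Rightarrow> rat poly poly" where
  "P_scaled_explicit n r s = scaled_binom [:0, 1:] 0 n
     - of_nat s * (\<Sum>j\<le>r. scaled_binom [:-1, 1:] 0 j * scaled_binom 1 (-1) (n - j))"

lemma poly_P_scaled_explicit:
  assumes "r < n" and "m \<ge> 1"
  shows "poly (P_scaled_explicit n r s) (of_nat m) = pcompose (P_poly n r s m) [:0, of_nat m:]"
proof (rule poly_ext)
  fix x :: rat
  have "poly (poly (P_scaled_explicit n r s) (of_nat m)) x
      = rising_binom (of_nat m * x + 1) n - of_nat s *
        (\<Sum>j\<le>r. rising_binom (of_nat m * x - of_nat m + 1) j * rising_binom (of_nat m) (n - j))"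
    by (simp add: P_scaled_explicit_def poly_sum poly_poly_scaled_binom of_nat_poly algebra_simps)
  also have "\<dots> = poly (pcompose (P_poly n r s m) [:0, of_nat m:]) x"
    using assms by (simp add: P_poly_def poly_pcompose poly_binom_poly poly_c_poly mult.commute)
  finally show "poly (poly (P_scaled_explicit n r s) (of_nat m)) x
      = poly (pcompose (P_poly n r s m) [:0, of_nat m:]) x" .
qed

lemma poly_eqI_positive_nats:
  fixes p q :: "'a::{idom, ring_char_0} poly"
  assumes "\<And>m::nat. m \<ge> 1 \<Longrightarrow> poly p (of_nat m) = poly q (of_nat m)"
  shows "p = q"
proof (rule ccontr)
  assume "p \<noteq> q"
  then have "finite {x. poly (p - q) x = 0}"
    by (intro poly_roots_finite) simp
  moreover have "of_nat ` {1..} \<subseteq> {x. poly (p - q) x = 0}"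
    using assms by auto
  ultimately have "finite ((of_nat :: nat \<Rightarrow> 'a) ` {1..})"
    by (rule rev_finite_subset)
  then show False
    by (simp add: finite_image_iff inj_on_def infinite_Ici)
qed

lemma P_scaled_eq:
  assumes "r < n"
  shows "P_scaled n r s = P_scaled_explicit n r s"
  unfolding P_scaled_def
proof (rule the_equality)
  show "\<forall>m\<ge>1. poly (P_scaled_explicit n r s) (of_nat m)
      = pcompose (P_poly n r s m) [:0, of_nat m:]"
    using assms by (simp add: poly_P_scaled_explicit)
next
  fix Q
  assume "\<forall>m\<ge>1. poly Q (of_nat m) = pcompose (P_poly n r s m) [:0, of_nat m:]"
  with assms show "Q = P_scaled_explicit n r s"
    by (intro poly_eqI_positive_nats) (simp add: poly_P_scaled_explicit)
qed

section \<open>The leading coefficient and its largest root\<close>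

lemma smult_sum_right: "smult a (\<Sum>i\<in>A. f i) = (\<Sum>i\<in>A. smult a (f i))"
  by (induction A rule: infinite_finite_induct) (simp_all add: smult_add_right)

lemma Lambda_formula:
  assumes "r < n"
  shows "Lambda n r s = smult (1 / fact n)
    (monom 1 n - smult (of_nat s) (\<Sum>j\<le>r. smult (of_nat (n choose j)) ([:-1, 1:] ^ j)))"
proof -
  have summand: "coeff (scaled_binom [:-1, 1:] 0 j * scaled_binom 1 (-1) (n - j)) n
      = smult (1 / fact n) (smult (of_nat (n choose j)) ([:-1, 1:] ^ j))" if "j \<le> r" for j
  proof -
    have "j \<le> n"
      using that assms by simp
    then have "coeff (scaled_binom [:-1, 1:] 0 j * scaled_binom 1 (-1) (n - j)) n
        = smult (1 / fact j) ([:-1, 1:] ^ j) * smult (1 / fact (n - j)) 1"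
      using coeff_mult_degree_bound[OF degree_scaled_binom_le[of "[:-1, 1:]" 0 j]
          degree_scaled_binom_le[of 1 "-1" "n - j"]]
      by (simp add: coeff_scaled_binom)
    with \<open>j \<le> n\<close> show ?thesis
      by (simp add: binomial_fact mult.commute)
  qed
  have "coeff (of_nat s * q) n = smult (of_nat s) (coeff q n)" for q :: "rat poly poly"
    by (simp add: of_nat_poly)
  then have "Lambda n r s = smult (1 / fact n) ([:0, 1:] ^ n)
      - smult (of_nat s)
          (\<Sum>j\<le>r. smult (1 / fact n) (smult (of_nat (n choose j)) ([:-1, 1:] ^ j)))"
    using assms
    by (simp add: Lambda_def P_scaled_eq P_scaled_explicit_def coeff_scaled_binom coeff_sum
        summand del: smult_smult)
  also have "\<dots> = smult (1 / fact n)
    (monom 1 n - smult (of_nat s) (\<Sum>j\<le>r. smult (of_nat (n choose j)) ([:-1, 1:] ^ j)))"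
    by (simp add: monom_altdef smult_diff_right smult_sum_right mult_ac)
  finally show ?thesis .
qed

lemma Lambda_0:
  assumes "0 < n"
  shows "Lambda n 0 s = smult (1 / fact n) (monom 1 n - [:of_nat s:])"
  using Lambda_formula[OF assms] by simp

lemma Greatest_root:
  assumes "0 < n"
  shows "(GREATEST x::real. x ^ n = real s) = root n (real s)"
proof (rule Greatest_equality)
  show "root n (real s) ^ n = real s"
    using assms by simp
next
  fix y :: real
  assume "y ^ n = real s"
  then show "y \<le> root n (real s)"
    using assms real_root_power_cancel[of n y] real_root_ge_zero[of "real s" n]
    by (cases "0 \<le> y") (simp, linarith)
qed

lemma g_0:
  assumes "0 < n"
  shows "g n 0 s = root n (real s)"
proof -
  have of_rat_fact: "real_of_rat (fact n) = fact n"
    by (metis of_nat_fact of_rat_of_nat_eq)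
  have "map_poly of_rat (Lambda n 0 s)
      = smult (1 / fact n) (monom 1 n - [:real s:])"
    unfolding Lambda_0[OF assms]
    by (rule poly_eqI)
      (simp add: coeff_map_poly of_rat_mult of_rat_diff of_rat_divide of_rat_fact coeff_pCons
        split: nat.split del: fact_Suc)
  then have "poly (map_poly of_rat (Lambda n 0 s)) x = 0 \<longleftrightarrow> x ^ n = real s" for x :: real
    by (simp add: poly_monom)
  then show ?thesis
    using assms by (simp add: g_def Greatest_root)
qed

theorem proposition2p10:
  fixes n r s :: nat
  assumes "n \<ge> 2 * r + 1" and "s \<ge> 1"
  shows "Lambda n r s =
           smult (1 / fact n)
             (monom 1 n - smult (of_nat s) (\<Sum>j=0..r. smult (of_nat (n choose j)) ([:-1, 1:] ^ j)))
         \<and> Lambda n 0 s = smult (1 / fact n) (monom 1 n - [:of_nat s:])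
         \<and> g n 0 s = root n (real s)"
proof -
  have "r < n" and "0 < n"
    using assms(1) by auto
  then show ?thesis
    by (intro conjI Lambda_0 g_0) (simp_all only: Lambda_formula atLeast0AtMost)
qed

end
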